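(* Let $A\subset\mathbb{R}^n$ be a nonempty compact set, let $N\ge 1$, and let $f:[0,\infty)\to[0,\infty)$ be continuous and strictly monotonically decreasing. Let $C$ be an $N$-point configuration in $\mathbb{R}^n$. Then $$\operatorname{Dark}_A(C)\subset \operatorname{int}\bigl(\operatorname{conv}(C)\bigr)\cup\partial A .$$ Moreover, if $C$ is locally optimal for the maximal polarization problem $\sup_{C} P_{f,A}(C)$ (the supremum over all $N$-point configurations in $\mathbb{R}^n$), then $\operatorname{Dark}_A(C)\cap\partial A\neq\emptyset$.
   Context: An $N$-point configuration is a multiset $C=\{c_1,\dots,c_N\}$ of $N$ points of $\mathbb{R}^n$ (repetitions allowed). For $p\in\mathbb{R}^n$ put $U(p,C)=\sum_{c\in C} f(\|p-c\|)$ (summing with multiplicity; $\|\cdot\|$ is the Euclidean norm), and let $P_{f,A}(C)=\inf_{p\in A}U(p,C)$. The set of darkest points is $\operatorname{Dark}_A(C)=\{p\in A : U(p,C)=P_{f,A}(C)\}$. The configuration $C=\{c_1,\dots,c_N\}$ is locally optimal if there is $\delta>0$ such that $P_{f,A}(C')\le P_{f,A}(C)$ for every configuration $C'=\{c_1',\dots,c_N'\}$ with $\|c_i'-c_i\|<\delta$ for all $i$. Interior $\operatorname{int}$ and boundary $\partial$ are taken in $\mathbb{R}^n$. *)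

theory Defs
  imports "HOL-Analysis.Analysis" "HOL-Library.Multiset"
begin

definition potential :: "(real \<Rightarrow> real) \<Rightarrow> real ^ 'n \<Rightarrow> (real ^ 'n) multiset \<Rightarrow> real" where
  "potential f p C = (\<Sum>c\<in>#C. f (norm (p - c)))"

definition polarization :: "(real \<Rightarrow> real) \<Rightarrow> (real ^ 'n) set \<Rightarrow> (real ^ 'n) multiset \<Rightarrow> real" where
  "polarization f A C = (INF p\<in>A. potential f p C)"

definition Dark :: "(real \<Rightarrow> real) \<Rightarrow> (real ^ 'n) set \<Rightarrow> (real ^ 'n) multiset \<Rightarrow> (real ^ 'n) set" where
  "Dark f A C = {p \<in> A. potential f p C = polarization f A C}"

text \<open>
  \<^term>\<open>rel_mset R C C'\<close> says that \<open>C\<close> and \<open>C'\<close> can be enumerated as \<open>c\<^sub>1, \<dots>, c\<^sub>N\<close> and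
  \<open>c'\<^sub>1, \<dots>, c'\<^sub>N\<close>, with repetitions and with the same \<open>N\<close>, such that
  \<open>R c\<^sub>i c'\<^sub>i\<close> for every \<open>i\<close>.
\<close>
definition locally_optimal :: "(real \<Rightarrow> real) \<Rightarrow> (real ^ 'n) set \<Rightarrow> (real ^ 'n) multiset \<Rightarrow> bool" where
  "locally_optimal f A C \<longleftrightarrow>
    (\<exists>\<delta>>0. \<forall>C'. rel_mset (\<lambda>c c'. norm (c' - c) < \<delta>) C C' \<longrightarrow>
      polarization f A C' \<le> polarization f A C)"

end

theory Submission
  imports Defs
begin

text \<open>
  If an interior point \<open>p\<close> of \<open>A\<close> lies outside the interior of the convex hull of \<open>C\<close>, then moving
  \<open>p\<close> away from the hull along a separating direction increases its distance to every point of
  \<open>C\<close>, so \<open>p\<close> is not darkest.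

  If no darkest point lies on the frontier of \<open>A\<close>, then by this all of them lie in the interior of
  the hull. Let \<open>c\<close> minimize a linear functional \<open>w \<bullet> _\<close> over \<open>C\<close>. Then \<open>w \<bullet> (p - c) > 0\<close> for every
  darkest \<open>p\<close>, so a small displacement of \<open>c\<close> along \<open>w\<close> brings it closer to all darkest points and,
  by compactness, raises the minimum of the potential.
\<close>

text \<open>A flat \<open>S\<close> lies in a hyperplane, whose normal is oriented towards
  \<open>p\<close>. Otherwise \<open>p\<close> is separated from the nonempty interior of
  \<open>S\<close>.\<close>

lemma separating_direction_not_interior:
  fixes S :: "'a::euclidean_space set"
  assumes "convex S" and "p \<notin> interior S"
  obtains v where "v \<noteq> 0" and "\<And>x. x \<in> S \<Longrightarrow> v \<bullet> x \<le> v \<bullet> p"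
proof (cases "interior S = {}")
  case True
  then obtain a b where a: "a \<noteq> 0" "S \<subseteq> {x. a \<bullet> x = b}"
    using empty_interior_subset_hyperplane \<open>convex S\<close> by blast
  show ?thesis
  proof (cases "b \<le> a \<bullet> p")
    case True
    show ?thesis using a True by (intro that[of a]) auto
  next
    case False
    show ?thesis using a False by (intro that[of "- a"]) auto
  qed
next
  case False
  obtain a b where a: "a \<noteq> 0" "\<And>x. x \<in> interior S \<Longrightarrow> a \<bullet> x \<le> b" "b \<le> a \<bullet> p"
    using separating_hyperplane_sets[of "interior S" "{p}"] assms False
    by (auto simp: convex_interior)
  \<comment> \<open>The weak bound survives closure, and a convex set with nonempty interior lies in
    the closure of that interior.\<close>
  have "closure (interior S) \<subseteq> {x. a \<bullet> x \<le> b}"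
    using a(2) by (intro closure_minimal closed_halfspace_le) auto
  then have "S \<subseteq> {x. a \<bullet> x \<le> b}"
    using convex_closure_interior[OF \<open>convex S\<close> False] closure_subset by blast
  then show ?thesis using a by (intro that[of a]) force+
qed

text \<open>In the expansion of the squared norm of \<open>x + v\<close> the cross term is
  nonnegative and \<open>v \<bullet> v\<close> is positive.\<close>

lemma norm_add_gt_if_inner_nonneg:
  fixes v x :: "'a::real_inner"
  assumes "v \<noteq> 0" and "0 \<le> v \<bullet> x"
  shows "norm x < norm (x + v)"
proof -
  have "0 < v \<bullet> v" using assms by simp
  then have "x \<bullet> x < (x + v) \<bullet> (x + v)"
    using assms(2) by (simp add: inner_add_left inner_add_right inner_commute del: inner_gt_zero_iff)
  then show ?thesis by (simp add: norm_lt)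
qed

lemma potential_empty [simp]: "potential f p {#} = 0"
  by (simp add: potential_def)

lemma potential_add_mset [simp]:
  "potential f p (add_mset c C) = f (norm (p - c)) + potential f p C"
  by (simp add: potential_def)

lemma potential_nonneg:
  assumes "f \<in> {0..} \<rightarrow> {0..}"
  shows "0 \<le> potential f p C"
proof (induction C)
  case (add c C)
  have "0 \<le> f (norm (p - c))" using assms by (auto simp: Pi_iff)
  then show ?case using add by simp
qed simp

lemma potential_strict_mono:
  assumes "C \<noteq> {#}" and "\<And>c. c \<in># C \<Longrightarrow> f (norm (p - c)) < f (norm (q - c))"
  shows "potential f p C < potential f q C"
  using assms
proof (induction C)
  case (add c C)
  then show ?case by (cases "C = {#}") (auto intro!: add_strict_mono)
qed simp

lemma continuous_on_potential:
  assumes "continuous_on {0..} f"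
  shows "continuous_on S (\<lambda>p. potential f p C)"
proof (induction C)
  case (add c C)
  have "continuous_on S (\<lambda>p. f (norm (p - c)))"
    by (intro continuous_on_compose2[OF assms] continuous_intros) auto
  then show ?case using add by (simp add: continuous_on_add)
qed simp

text \<open>Nonnegativity of \<open>f\<close> bounds all potentials below by 0, so the real infimum
  is a genuine lower bound.\<close>

lemma polarization_le_potential:
  assumes "f \<in> {0..} \<rightarrow> {0..}" and "p \<in> A"
  shows "polarization f A C \<le> potential f p C"
  unfolding polarization_def using assms
  by (intro cINF_lower bdd_belowI[of _ 0]) (auto intro: potential_nonneg)

lemma polarization_attained:
  assumes "compact A" and "A \<noteq> {}" and "f \<in> {0..} \<rightarrow> {0..}" and "continuous_on {0..} f"
  obtains p where "p \<in> A" and "potential f p C = polarization f A C"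
proof -
  obtain p where p: "p \<in> A" "\<And>q. q \<in> A \<Longrightarrow> potential f p C \<le> potential f q C"
    using continuous_attains_inf[OF assms(1,2) continuous_on_potential[OF assms(4)]] by blast
  then have "potential f p C \<le> polarization f A C"
    unfolding polarization_def by (intro cINF_greatest assms)
  then show ?thesis using that p(1) polarization_le_potential[OF assms(3) p(1), of C] by force
qed

lemma Dark_subset:
  assumes anti: "strict_antimono_on {0..} f" and nonneg: "f \<in> {0..} \<rightarrow> {0..}"
    and "C \<noteq> {#}"
  shows "Dark f A C \<subseteq> interior (convex hull (set_mset C)) \<union> frontier A"
proof
  fix p assume p: "p \<in> Dark f A C"
  show "p \<in> interior (convex hull (set_mset C)) \<union> frontier A"
  proof (rule ccontr)
    assume contr: "\<not> ?thesis"
    then obtain v where v: "v \<noteq> 0" "\<And>x. x \<in> convex hull (set_mset C) \<Longrightarrow> v \<bullet> x \<le> v \<bullet> p"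
      using separating_direction_not_interior[OF convex_convex_hull] by auto
    have "p \<in> interior A"
      using p contr closure_subset by (auto simp: Dark_def frontier_def)
    then obtain e where e: "e > 0" "cball p e \<subseteq> A"
      using mem_interior_cball by blast
    \<comment> \<open>A step of length exactly \<open>e\<close> in direction \<open>v\<close> stays
      in the closed ball around \<open>p\<close>, hence in \<open>A\<close>.\<close>
    define q where "q = p + (e / norm v) *\<^sub>R v"
    have "dist p q = e" using v e by (simp add: q_def dist_norm)
    then have "q \<in> A" using e by auto
    have "potential f q C < potential f p C"
    proof (rule potential_strict_mono[OF \<open>C \<noteq> {#}\<close>])
      fix c assume "c \<in># C"
      then have "v \<bullet> c \<le> v \<bullet> p" by (intro v hull_inc)
      then have "norm (p - c) < norm (p - c + (e / norm v) *\<^sub>R v)"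
        using v e by (intro norm_add_gt_if_inner_nonneg)
          (auto simp: inner_diff_right divide_right_mono)
      then have "norm (p - c) < norm (q - c)" by (simp add: q_def algebra_simps)
      then show "f (norm (q - c)) < f (norm (p - c))"
        using monotone_onD[OF anti, of "norm (p - c)" "norm (q - c)"] by simp
    qed
    moreover have "potential f p C \<le> potential f q C"
      using p polarization_le_potential[OF nonneg \<open>q \<in> A\<close>, of C] by (simp add: Dark_def)
    ultimately show False by simp
  qed
qed

text \<open>The hull lies in a closed halfspace. Since \<open>w \<noteq> 0\<close>, the interior of
  that halfspace is the open one, which gives strictness.\<close>

lemma interior_convex_hull_inner_gt:
  fixes w :: "'a::euclidean_space"
  assumes "w \<noteq> 0" and "\<And>x. x \<in> S \<Longrightarrow> b \<le> w \<bullet> x" and "p \<in> interior (convex hull S)"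
  shows "b < w \<bullet> p"
proof -
  have "convex hull S \<subseteq> {x. w \<bullet> x \<ge> b}"
    using assms by (intro hull_minimal convex_halfspace_ge) auto
  then have "interior (convex hull S) \<subseteq> {x. w \<bullet> x > b}"
    using interior_mono[of _ "{x. w \<bullet> x \<ge> b}"] assms(1) by (simp add: interior_halfspace_ge)
  then show ?thesis using assms(3) by auto
qed

text \<open>If no such \<open>c'\<close> existed, minimizers for ever smaller displacements of
  \<open>c\<close> along \<open>w\<close> would accumulate at a darkest point \<open>q\<close> of
  the original configuration. The hypothesis on \<open>w\<close> at \<open>q\<close> then
  contradicts the minimality of the polarization.\<close>

lemma polarization_increases_along:
  fixes A :: "(real ^ 'n) set"
  assumes "compact A" and "A \<noteq> {}" and nonneg: "f \<in> {0..} \<rightarrow> {0..}"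
    and cont: "continuous_on {0..} f" and anti: "strict_antimono_on {0..} f"
    and towards: "\<And>p. p \<in> Dark f A (add_mset c B) \<Longrightarrow> 0 < w \<bullet> (p - c)"
    and "\<delta> > 0"
  obtains c' where "norm (c' - c) < \<delta>"
    and "polarization f A (add_mset c B) < polarization f A (add_mset c' B)"
proof (rule ccontr)
  note thesis_if = that
  assume "\<not> thesis"
  have le: "polarization f A (add_mset c' B) \<le> polarization f A (add_mset c B)"
    if "norm (c' - c) < \<delta>" for c'
    using that thesis_if \<open>\<not> thesis\<close> by force
  define t where "t k = inverse (real (Suc k))" for k
  have t_pos: "t k > 0" for k by (simp add: t_def)
  have t_lim: "t \<longlonglongrightarrow> 0" unfolding t_def by (rule LIMSEQ_inverse_real_of_nat)
  have "\<exists>p\<in>A. potential f p (add_mset (c + t k *\<^sub>R w) B) =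
      polarization f A (add_mset (c + t k *\<^sub>R w) B)" for k
    using polarization_attained[OF assms(1-4)] by metis
  then obtain p where p: "\<And>k. p k \<in> A"
    "\<And>k. potential f (p k) (add_mset (c + t k *\<^sub>R w) B) =
      polarization f A (add_mset (c + t k *\<^sub>R w) B)"
    by metis
  obtain q r where q: "q \<in> A" "strict_mono r" "(p \<circ> r) \<longlonglongrightarrow> q"
    using \<open>compact A\<close> p(1) unfolding compact_def by metis
  define s where "s k = t (r k)" for k
  define x where "x k = p (r k)" for k
  have s_lim: "s \<longlonglongrightarrow> 0"
    using LIMSEQ_subseq_LIMSEQ[OF t_lim q(2)] by (simp add: s_def[abs_def] o_def)
  have x_lim: "x \<longlonglongrightarrow> q" using q(3) by (simp add: x_def[abs_def] o_def)
  have "(\<lambda>k. norm (s k *\<^sub>R w)) \<longlonglongrightarrow> norm (0 *\<^sub>R w)"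
    by (intro tendsto_intros s_lim)
  then have "\<forall>\<^sub>F k in sequentially. norm (s k *\<^sub>R w) < \<delta>"
    using \<open>\<delta> > 0\<close> by (intro order_tendstoD) auto
  \<comment> \<open>Only eventually: \<open>le\<close> applies once the displacement is shorter than
    \<open>\<delta>\<close>.\<close>
  then have upper: "\<forall>\<^sub>F k in sequentially.
      f (norm (x k - (c + s k *\<^sub>R w))) + potential f (x k) B \<le> polarization f A (add_mset c B)"
  proof eventually_elim
    case (elim k)
    then show ?case using le[of "c + s k *\<^sub>R w"] p(2)[of "r k"] by (simp add: s_def x_def)
  qed
  have "(\<lambda>k. norm (x k - (c + s k *\<^sub>R w))) \<longlonglongrightarrow> norm (q - (c + 0 *\<^sub>R w))"
    by (intro tendsto_intros s_lim x_lim)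
  then have "(\<lambda>k. f (norm (x k - (c + s k *\<^sub>R w)))) \<longlonglongrightarrow> f (norm (q - c))"
    by (intro continuous_on_tendsto_compose[OF cont]) auto
  moreover have "(\<lambda>k. potential f (x k) B) \<longlonglongrightarrow> potential f q B"
    by (rule continuous_on_tendsto_compose[OF continuous_on_potential[OF cont, of UNIV] x_lim]) auto
  ultimately have "potential f q (add_mset c B) \<le> polarization f A (add_mset c B)"
    using tendsto_upperbound[OF tendsto_add upper] by simp
  then have "q \<in> Dark f A (add_mset c B)"
    using polarization_le_potential[OF nonneg q(1), of "add_mset c B"] q(1)
    by (simp add: Dark_def)
  then have "0 < w \<bullet> (q - c)" by (rule towards)
  moreover have "(\<lambda>k. w \<bullet> (x k - (c + s k *\<^sub>R w))) \<longlonglongrightarrow> w \<bullet> (q - (c + 0 *\<^sub>R w))"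
    by (intro tendsto_intros s_lim x_lim)
  \<comment> \<open>Positivity is needed at the displaced point: it says that the move along
    \<open>w\<close> does not overshoot, so undoing it increases the distance to
    \<open>x k\<close>.\<close>
  ultimately have "\<forall>\<^sub>F k in sequentially. 0 < w \<bullet> (x k - (c + s k *\<^sub>R w))"
    by (intro order_tendstoD) auto
  then obtain k where k: "0 < w \<bullet> (x k - (c + s k *\<^sub>R w))"
    "f (norm (x k - (c + s k *\<^sub>R w))) + potential f (x k) B \<le> polarization f A (add_mset c B)"
    using upper eventually_happens[OF eventually_conj] trivial_limit_sequentially by blast
  have "s k > 0" by (simp add: s_def t_pos)
  moreover have "w \<noteq> 0" using k(1) by auto
  ultimately have "norm (x k - (c + s k *\<^sub>R w)) < norm (x k - (c + s k *\<^sub>R w) + s k *\<^sub>R w)"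
    using k(1) by (intro norm_add_gt_if_inner_nonneg) auto
  then have "norm (x k - (c + s k *\<^sub>R w)) < norm (x k - c)" by (simp add: algebra_simps)
  \<comment> \<open>Hence the original potential at \<open>x k\<close> is strictly below the
    displaced one, which is at most the original polarization.\<close>
  then have "f (norm (x k - c)) < f (norm (x k - (c + s k *\<^sub>R w)))"
    by (intro monotone_onD[OF anti]) auto
  moreover have "polarization f A (add_mset c B) \<le> potential f (x k) (add_mset c B)"
    by (intro polarization_le_potential[OF nonneg]) (simp add: x_def p)
  ultimately show False using k(2) by simp
qed

theorem theorem2p5:
  fixes A :: "(real ^ 'n) set" and N :: nat and f :: "real \<Rightarrow> real"
    and C :: "(real ^ 'n) multiset"
  assumes "compact A" and "A \<noteq> {}"
    and "N \<ge> 1"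
    and "f \<in> {0..} \<rightarrow> {0..}"
    and "continuous_on {0..} f"
    and "strict_antimono_on {0..} f"
    and "size C = N"
  shows "Dark f A C \<subseteq> interior (convex hull (set_mset C)) \<union> frontier A
    \<and> (locally_optimal f A C \<longrightarrow> Dark f A C \<inter> frontier A \<noteq> {})"
proof (intro conjI impI)
  have "C \<noteq> {#}" using assms(3,7) by auto
  then show sub: "Dark f A C \<subseteq> interior (convex hull (set_mset C)) \<union> frontier A"
    by (intro Dark_subset assms)
  assume "locally_optimal f A C"
  then obtain \<delta> where \<delta>: "\<delta> > 0"
    "\<And>C'. rel_mset (\<lambda>c c'. norm (c' - c) < \<delta>) C C' \<Longrightarrow> polarization f A C' \<le> polarization f A C"
    unfolding locally_optimal_def by blast
  show "Dark f A C \<inter> frontier A \<noteq> {}"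
  proof
    assume disj: "Dark f A C \<inter> frontier A = {}"
    obtain w :: "real ^ 'n" where w: "w \<noteq> 0" using nonempty_Basis nonzero_Basis by blast
    obtain c where c: "c \<in># C" "\<And>x. x \<in># C \<Longrightarrow> w \<bullet> c \<le> w \<bullet> x"
      using arg_min_if_finite[of "set_mset C" "\<lambda>x. w \<bullet> x"] \<open>C \<noteq> {#}\<close>
      by (metis finite_set_mset not_le set_mset_eq_empty_iff)
    \<comment> \<open>Only one copy of \<open>c\<close> will be moved; \<open>B\<close> holds the
      remaining points, including any further copies of \<open>c\<close>.\<close>
    obtain B where B: "C = add_mset c B" using c(1) by (metis insert_DiffM)
    have "0 < w \<bullet> (p - c)" if "p \<in> Dark f A (add_mset c B)" for p
    proof -
      have "p \<in> interior (convex hull (set_mset C))" using that sub disj B by auto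
      then have "w \<bullet> c < w \<bullet> p"
        by (rule interior_convex_hull_inner_gt[rotated 2]) (use w c in auto)
      then show ?thesis by (simp add: inner_diff_right)
    qed
    then obtain c' where c': "norm (c' - c) < \<delta>" "polarization f A C < polarization f A (add_mset c' B)"
      using polarization_increases_along[OF assms(1,2,4-6) _ \<delta>(1)] B by blast
    \<comment> \<open>The unmoved points are matched with themselves, at distance 0.\<close>
    have "rel_mset (\<lambda>c c'. norm (c' - c) < \<delta>) B B"
      using \<delta>(1) by (intro multiset.rel_refl) auto
    then have "rel_mset (\<lambda>c c'. norm (c' - c) < \<delta>) C (add_mset c' B)"
      unfolding B using c'(1) by (intro rel_mset_Plus)
    then show False using \<delta>(2) c'(2) by force
  qed
qed

end
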